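(* For any procedure $p$ with body $S_p$ and procedure (Hoare logic) contract $C_p$, abstracted into component $m_p$ with contract $c_p$ (i.e. $m_p$ is the component abstracting the procedure set $\{p\}$ and $c_p$ is the denotational contract abstracting $C_p$), we have $$S_p\models^{\mathit{cr}}_{\mathit{par}}C_p\quad\text{if and only if}\quad m_p\models c_p.$$
   Context: Language. Let $\mathcal{P}$ be a finite set of procedure names. Statements are given by $S::=\mathsf{skip}\mid x:=a\mid S_1;S_2\mid\mathsf{if}\ b\ \mathsf{then}\ S_1\ \mathsf{else}\ S_2\mid\mathsf{while}\ b\ \mathsf{do}\ S\mid\mathsf{call}\ p$ with $p\in\mathcal{P}$, $a$ arithmetic and $b$ Boolean expressions over the (global, integer-valued) program variables. Declared procedures have declarations $\mathsf{proc}\ p\ \mathsf{is}\ S_p$. A procedure $p$ calls $p'$ if $\mathsf{call}\ p'$ occurs in $S_p$. $\mathbf{State}$ is the set of mappings from program variables to integers. Environments. For $P\subseteq\mathcal{P}$, $\mathbf{Env}_P$ is the set of functions $P\to 2^{\mathbf{State}\times\mathbf{State}}$. For $\rho\in\mathbf{Env}_P$, $\rho'\in\mathbf{Env}_{P'}$, $\rho\sqsubseteq\rho'$ iff $P\subseteq P'$ and $\rho(p)\subseteq\rho'(p)$ for all $p\in P$; $\sqcup$ denotes the lub ($\rho_1\sqcup\rho_2\in\mathbf{Env}_{P_1\cup P_2}$, $p\mapsto\rho_1(p)\cup\rho_2(p)$, reading $\rho_i(p)=\varnothing$ if $p\notin P_i$); $\rho^\top_P\in\mathbf{Env}_P$ maps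 every $p\in P$ to $\mathbf{State}\times\mathbf{State}$. An interface is a pair $(P^-,P^+)$ of disjoint sets of procedure names (required, provided). Denotations. For an interface $(P^-,P^+)$, $\rho^-\in\mathbf{Env}_{P^-}$ and $\rho^+\in\mathbf{Env}_{P^+}$, the denotation $[\![S]\!]^{\rho^+}_{\rho^-}\subseteq\mathbf{State}\times\mathbf{State}$ is the standard relational one, by induction on $S$: $\mathsf{skip}$ denotes the identity relation; $x:=a$ denotes $\{(s,s[x\mapsto a(s)])\}$, where $a(s)$ is the value of $a$ in $s$; $S_1;S_2$ denotes the relational composition (first $S_1$, then $S_2$); the conditional denotes the union of the denotation of $S_1$ restricted to initial states satisfying $b$ and that of $S_2$ restricted to initial states not satisfying $b$; $\mathsf{while}\ b\ \mathsf{do}\ S$ denotes the least relation $R$ such that $R=\{(s,s)\mid s\not\models b\}\cup\{(s,s'')\mid s\models b,\ \exists s'.\,(s,s')\in[\![S]\!]^{\rho^+}_{\rho^-},(s',s'')\in R\}$; and $[\![\mathsf{call}\ p]\!]^{\rho^+}_{\rho^-}$ is $\rho^-(p)$ if $p\in P^-$ and $\rho^+(p)$ if $p\in P^+$. Given $\rho^-\in\mathbf{Env}_{P^-}$, let $\xi:\mathbf{Env}_{P^+}\to\mathbf{Env}_{P^+}$ be $\xi(\rho^+)(p)=[\![S_p]\!]^{\rho^+}_{\rho^-}$ for $p\in P^+$; it is monotonic, and $\rho^+_0$ denotes its least fixed point. The standard denotation is $[\![S]\!]_{\rho^-}:=[\![S]\!]^{\rho^+_0}_{\rho^-}$. Hoare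 logic contracts. A Hoare logic contract is a pair $C=(P,Q)$ of assertions (pre- and post-condition) over program variables and logical variables; logical variables are given values by interpretations $\mathcal{I}$, and $s\models_{\mathcal{I}}P$ means $P$ is true in state $s$ under $\mathcal{I}$. Its denotation is $[\![C]\!]:=\{(s,s')\mid\forall\mathcal{I}.\ (s\models_{\mathcal{I}}P\Rightarrow s'\models_{\mathcal{I}}Q)\}$. Every procedure $p\in\mathcal{P}$ is equipped with a contract $C_p$. The contract environment $\rho_c\in\mathbf{Env}_{\mathcal{P}}$ is $\rho_c(p):=[\![C_p]\!]$ for all $p\in\mathcal{P}$. The contract-relative denotation of a statement is $[\![S]\!]^{cr}:=[\![S]\!]_{\rho_c}$, i.e. every call $\mathsf{call}\ p$, $p\in\mathcal{P}$, is interpreted as $\rho_c(p)$ (no fixed point is involved). $S\models^{\mathit{cr}}_{\mathit{par}}C$ iff $[\![S]\!]^{cr}\subseteq[\![C]\!]$. Components and denotational contracts. A component $m$ with interface $(P^-_m,P^+_m)$ is a mapping $m:\mathbf{Env}_{P^-_m}\to\mathbf{Env}_{P^+_m}$. A denotational contract $c$ with interface $(P^-_c,P^+_c)$ is a pair $(\rho^-_c,\rho^+_c)\in\mathbf{Env}_{P^-_c}\times\mathbf{Env}_{P^+_c}$. $m\models c$ ($m$ implements $c$) iff $P^-_c\subseteq P^-_m$, $P^+_m\subseteq P^+_c$ and $m(\rho^-_c\sqcup\rho^\top_{P^-_m\setminus P^-_c})\sqsubseteq\rho^+_c$. Abstractions. A set $P^+$ of declared procedures, whose set of called procedures is $P'$,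 is abstracted into the component $m$ with $P^+_m:=P^+$, $P^-_m:=P'\setminus P^+_m$ and $m(\rho^-_m)(p):=[\![S_p]\!]_{\rho^-_m}$ for all $\rho^-_m\in\mathbf{Env}_{P^-_m}$, $p\in P^+_m$, the standard denotation being taken in the context of the interface $(P^-_m,P^+_m)$. For a procedure $p$ with Hoare logic contract $C_p$, calling other procedures $P^-$, the denotational contract $c_p=(\rho^-_{c_p},\rho^+_{c_p})$ has $P^+_{c_p}:=\{p\}$, $P^-_{c_p}:=P^-$, $\rho^+_{c_p}(p):=\rho_c(p)$, and $\rho^-_{c_p}(p'):=\rho_c(p')$ for all $p'\in P^-$.
   Formalization: The equivalence is proved for procedures p that do not call themselves directly; for self-calling p only the forward implication is stated, since the converse fails there, e.g. for S_p = call p; x := 1 with contract (true, x = 0). *)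

theory Defs
  imports Main "HOL-Library.Option_ord"
begin

(* Arithmetic and Boolean expressions and assertions are given by their semantics, so that every
   concrete expression or assertion language is covered.  The finite set of all procedure names
   is the (finite) type 'p. *)

type_synonym 'v state = "'v \<Rightarrow> int"
type_synonym 'v rel = "('v state \<times> 'v state) set"

datatype ('v, 'p) stmt =
    Skip
  | Assign 'v "'v state \<Rightarrow> int"
  | Seq "('v, 'p) stmt" "('v, 'p) stmt"
  | Cond "'v state \<Rightarrow> bool" "('v, 'p) stmt" "('v, 'p) stmt"
  | While "'v state \<Rightarrow> bool" "('v, 'p) stmt"
  | Call 'p

primrec callees :: "('v, 'p) stmt \<Rightarrow> 'p set" where
  "callees Skip = {}"
| "callees (Assign x a) = {}"
| "callees (Seq S1 S2) = callees S1 \<union> callees S2"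
| "callees (Cond b S1 S2) = callees S1 \<union> callees S2"
| "callees (While b S) = callees S"
| "callees (Call p) = {p}"

text \<open>The domain of this map is the set of declared procedures.\<close>

type_synonym ('v, 'p) decls = "'p \<rightharpoonup> ('v, 'p) stmt"


section \<open>Environments\<close>

text \<open>
  An element of the set of environments over \<open>P\<close> is a partial function with domain exactly \<open>P\<close>.
  With the order on the option type in which \<open>None\<close> is the least element, the order \<open>\<le>\<close> and the
  binary supremum \<open>\<squnion>\<close> of partial functions are exactly the order and the least upper bound of
  environments over possibly different sets of procedures; see the two lemmas below.
\<close>

type_synonym ('v, 'p) env = "'p \<rightharpoonup> 'v rel"

definition Env :: "'p set \<Rightarrow> ('v, 'p) env set" where
  "Env P = {\<rho>. dom \<rho> = P}"

definition top_env :: "'p set \<Rightarrow> ('v, 'p) env" where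
  "top_env P = (\<lambda>p. if p \<in> P then Some UNIV else None)"

definition rel_at :: "('v, 'p) env \<Rightarrow> 'p \<Rightarrow> 'v rel" where
  "rel_at \<rho> p = (case \<rho> p of Some R \<Rightarrow> R | None \<Rightarrow> {})"

lemma env_le_iff:
  fixes \<rho> \<rho>' :: "('v, 'p) env"
  assumes "\<rho> \<in> Env P" "\<rho>' \<in> Env P'"
  shows "\<rho> \<le> \<rho>' \<longleftrightarrow> P \<subseteq> P' \<and> (\<forall>p\<in>P. rel_at \<rho> p \<subseteq> rel_at \<rho>' p)"
proof -
  have "\<rho> p \<le> \<rho>' p \<longleftrightarrow> (p \<in> P \<longrightarrow> p \<in> P' \<and> rel_at \<rho> p \<subseteq> rel_at \<rho>' p)" for p
    using assms by (cases "\<rho> p"; cases "\<rho>' p") (auto simp: Env_def rel_at_def)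
  then show ?thesis
    unfolding le_fun_def by blast
qed

lemma env_sup:
  fixes \<rho> \<rho>' :: "('v, 'p) env"
  assumes "\<rho> \<in> Env P" "\<rho>' \<in> Env P'"
  shows "sup \<rho> \<rho>' \<in> Env (P \<union> P')"
    and "rel_at (sup \<rho> \<rho>') p = rel_at \<rho> p \<union> rel_at \<rho>' p"
proof -
  have "p \<in> dom (sup \<rho> \<rho>') \<longleftrightarrow> p \<in> dom \<rho> \<union> dom \<rho>'" for p
    by (cases "\<rho> p"; cases "\<rho>' p") auto
  then show "sup \<rho> \<rho>' \<in> Env (P \<union> P')"
    using assms unfolding Env_def by blast
  show "rel_at (sup \<rho> \<rho>') p = rel_at \<rho> p \<union> rel_at \<rho>' p"
    by (cases "\<rho> p"; cases "\<rho>' p") (auto simp: rel_at_def)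
qed


section \<open>Denotations\<close>

text \<open>
  In \<open>denot \<rho>m \<rho>p S\<close> the environments \<open>\<rho>m\<close> and \<open>\<rho>p\<close> interpret the required and the provided
  procedures; the interface is given by their (disjoint) domains.  A call outside the interface,
  which does not arise for well-formed arguments, denotes the empty relation.
\<close>

primrec denot :: "('v, 'p) env \<Rightarrow> ('v, 'p) env \<Rightarrow> ('v, 'p) stmt \<Rightarrow> 'v rel" where
  "denot \<rho>m \<rho>p Skip = Id"
| "denot \<rho>m \<rho>p (Assign x a) = {(s, s(x := a s)) |s. True}"
| "denot \<rho>m \<rho>p (Seq S1 S2) = denot \<rho>m \<rho>p S1 O denot \<rho>m \<rho>p S2"
| "denot \<rho>m \<rho>p (Cond b S1 S2) =
     {(s, s'). b s \<and> (s, s') \<in> denot \<rho>m \<rho>p S1} \<union> {(s, s'). \<not> b s \<and> (s, s') \<in> denot \<rho>m \<rho>p S2}"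
| "denot \<rho>m \<rho>p (While b S) =
     lfp (\<lambda>R. {(s, s) |s. \<not> b s} \<union> {(s, s''). b s \<and> (\<exists>s'. (s, s') \<in> denot \<rho>m \<rho>p S \<and> (s', s'') \<in> R)})"
| "denot \<rho>m \<rho>p (Call q) = (if q \<in> dom \<rho>m then the (\<rho>m q) else rel_at \<rho>p q)"

definition xi :: "('v, 'p) decls \<Rightarrow> 'p set \<Rightarrow> ('v, 'p) env \<Rightarrow> ('v, 'p) env \<Rightarrow> ('v, 'p) env" where
  "xi procs Pp \<rho>m \<rho>p = (\<lambda>p. if p \<in> Pp then Some (denot \<rho>m \<rho>p (the (procs p))) else None)"

text \<open>
  The least fixed point is taken in the complete lattice of all partial functions.  Since every
  value of \<open>xi\<close> has domain \<open>Pp\<close>, it is the least fixed point among the environments over \<open>Pp\<close>;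
  see lemma \<open>least_env\<close>.
\<close>

definition least_env :: "('v, 'p) decls \<Rightarrow> 'p set \<Rightarrow> ('v, 'p) env \<Rightarrow> ('v, 'p) env" where
  "least_env procs Pp \<rho>m = lfp (xi procs Pp \<rho>m)"

definition std_denot ::
  "('v, 'p) decls \<Rightarrow> 'p set \<Rightarrow> ('v, 'p) env \<Rightarrow> ('v, 'p) stmt \<Rightarrow> 'v rel" where
  "std_denot procs Pp \<rho>m S = denot \<rho>m (least_env procs Pp \<rho>m) S"

lemma rel_at_mono: "\<rho> \<le> \<rho>' \<Longrightarrow> rel_at \<rho> p \<subseteq> rel_at \<rho>' p"
  using le_funD[of \<rho> \<rho>' p] by (cases "\<rho> p"; cases "\<rho>' p") (auto simp: rel_at_def)

lemma denot_mono: "\<rho>p \<le> \<rho>p' \<Longrightarrow> denot \<rho>m \<rho>p S \<subseteq> denot \<rho>m \<rho>p' S"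
proof (induction S)
  case (While b S)
  then have "denot \<rho>m \<rho>p S \<subseteq> denot \<rho>m \<rho>p' S" by simp
  then show ?case by (auto intro!: lfp_mono)
next
  case (Call q)
  then show ?case by (simp add: rel_at_mono)
qed auto

lemma mono_xi: "mono (xi procs Pp \<rho>m)"
  by (rule monoI) (simp add: xi_def le_fun_def denot_mono)

lemma least_env:
  shows "least_env procs Pp \<rho>m \<in> Env Pp"
    and "xi procs Pp \<rho>m (least_env procs Pp \<rho>m) = least_env procs Pp \<rho>m"
    and "\<And>\<rho>. \<rho> \<in> Env Pp \<Longrightarrow> xi procs Pp \<rho>m \<rho> = \<rho> \<Longrightarrow> least_env procs Pp \<rho>m \<le> \<rho>"
proof -
  show fp: "xi procs Pp \<rho>m (least_env procs Pp \<rho>m) = least_env procs Pp \<rho>m"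
    unfolding least_env_def by (rule lfp_fixpoint[OF mono_xi])
  have "xi procs Pp \<rho>m \<rho> \<in> Env Pp" for \<rho>
    by (auto simp: xi_def Env_def split: if_splits)
  with fp show "least_env procs Pp \<rho>m \<in> Env Pp"
    by metis
  show "least_env procs Pp \<rho>m \<le> \<rho>" if "xi procs Pp \<rho>m \<rho> = \<rho>" for \<rho>
    unfolding least_env_def using that by (intro lfp_lowerbound) simp
qed


section \<open>Hoare logic contracts\<close>

type_synonym ('l, 'w) interp = "'l \<Rightarrow> 'w"
type_synonym ('v, 'l, 'w) assn = "('l, 'w) interp \<Rightarrow> 'v state \<Rightarrow> bool"
type_synonym ('v, 'l, 'w) hoare_contract = "('v, 'l, 'w) assn \<times> ('v, 'l, 'w) assn"

definition contract_denot :: "('v, 'l, 'w) hoare_contract \<Rightarrow> 'v rel" where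
  "contract_denot C = {(s, s'). \<forall>I. fst C I s \<longrightarrow> snd C I s'}"

definition contract_env :: "('p \<Rightarrow> ('v, 'l, 'w) hoare_contract) \<Rightarrow> ('v, 'p) env" where
  "contract_env contr = (\<lambda>p. Some (contract_denot (contr p)))"

text \<open>In the contract-relative denotation all procedures are required and none is provided.\<close>

definition denot_cr ::
  "('v, 'p) decls \<Rightarrow> ('p \<Rightarrow> ('v, 'l, 'w) hoare_contract) \<Rightarrow> ('v, 'p) stmt \<Rightarrow> 'v rel" where
  "denot_cr procs contr S = std_denot procs {} (contract_env contr) S"

definition models_cr_par ::
  "('v, 'p) decls \<Rightarrow> ('p \<Rightarrow> ('v, 'l, 'w) hoare_contract) \<Rightarrow> ('v, 'p) stmt \<Rightarrow>
   ('v, 'l, 'w) hoare_contract \<Rightarrow> bool" where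
  "models_cr_par procs contr S C \<longleftrightarrow> denot_cr procs contr S \<subseteq> contract_denot C"


section \<open>Components and denotational contracts\<close>

text \<open>Only the values of \<open>run m\<close> on \<open>Env (required m)\<close> are meaningful.\<close>

record ('v, 'p) component =
  required :: "'p set"
  provided :: "'p set"
  run :: "('v, 'p) env \<Rightarrow> ('v, 'p) env"

definition is_component :: "('v, 'p) component \<Rightarrow> bool" where
  "is_component m \<longleftrightarrow>
     required m \<inter> provided m = {} \<and> (\<forall>\<rho>\<in>Env (required m). run m \<rho> \<in> Env (provided m))"

text \<open>The interface of a denotational contract consists of the domains of its two environments.\<close>

type_synonym ('v, 'p) dcontract = "('v, 'p) env \<times> ('v, 'p) env"

definition is_dcontract :: "('v, 'p) dcontract \<Rightarrow> bool" where
  "is_dcontract c \<longleftrightarrow> dom (fst c) \<inter> dom (snd c) = {}"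

definition implements :: "('v, 'p) component \<Rightarrow> ('v, 'p) dcontract \<Rightarrow> bool" where
  "implements m c \<longleftrightarrow>
     dom (fst c) \<subseteq> required m \<and> provided m \<subseteq> dom (snd c) \<and>
     run m (sup (fst c) (top_env (required m - dom (fst c)))) \<le> snd c"


section \<open>Abstractions\<close>

definition abs_component :: "('v, 'p) decls \<Rightarrow> 'p set \<Rightarrow> ('v, 'p) component" where
  "abs_component procs Pp =
     \<lparr>required = (\<Union>p\<in>Pp. callees (the (procs p))) - Pp,
      provided = Pp,
      run = (\<lambda>\<rho>m p. if p \<in> Pp then Some (std_denot procs Pp \<rho>m (the (procs p))) else None)\<rparr>"

text \<open>The required procedures are the procedures other than \<open>p\<close> that \<open>p\<close> calls.\<close>

definition abs_contract ::
  "('v, 'p) decls \<Rightarrow> ('p \<Rightarrow> ('v, 'l, 'w) hoare_contract) \<Rightarrow> 'p \<Rightarrow> ('v, 'p) dcontract" where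
  "abs_contract procs contr p =
     (contract_env contr |` (callees (the (procs p)) - {p}), contract_env contr |` {p})"

lemma is_component_abs_component: "is_component (abs_component procs Pp)"
  by (auto simp: is_component_def abs_component_def Env_def split: if_splits)

lemma is_dcontract_abs_contract: "is_dcontract (abs_contract procs contr p)"
  by (auto simp: is_dcontract_def abs_contract_def)

text \<open>
  If \<open>p\<close> calls itself, the component takes a least fixed point for these calls, whereas the
  contract-relative denotation replaces them by the contract of \<open>p\<close>.  Then the component can
  implement the contract although the body does not satisfy it contract-relatively.
\<close>

lemma recursive_counterexample:
  fixes procs :: "(unit, unit) decls" and contr :: "unit \<Rightarrow> (unit, unit, unit) hoare_contract"
  defines "S \<equiv> Seq (Call ()) (Assign () (\<lambda>_. 1))"
  defines "procs \<equiv> (\<lambda>_. Some S)" and "contr \<equiv> (\<lambda>_. (\<lambda>I s. True, \<lambda>I s. s () = 0))"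
  shows "implements (abs_component procs {()}) (abs_contract procs contr ())"
    and "\<not> models_cr_par procs contr S (contr ())"
proof -
  have "least_env procs {()} Map.empty \<le> (\<lambda>p. Some {})"
    unfolding least_env_def by (rule lfp_lowerbound) (auto simp: xi_def le_fun_def procs_def S_def rel_at_def)
  then have "denot Map.empty (least_env procs {()} Map.empty) S \<subseteq> denot Map.empty (\<lambda>p. Some {}) S"
    by (rule denot_mono)
  then have "denot Map.empty (least_env procs {()} Map.empty) S = {}" by (auto simp: S_def rel_at_def)
  moreover have "sup Map.empty (top_env {}) = (Map.empty :: (unit,unit) env)" by (rule ext) (simp add: top_env_def)
  ultimately show "implements (abs_component procs {()}) (abs_contract procs contr ())"
    by (auto simp: implements_def abs_component_def abs_contract_def le_fun_def std_denot_def contract_env_def procs_def)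
       (auto simp: S_def)
  have "((\<lambda>_. 0, \<lambda>_. 1) :: unit state \<times> unit state) \<in> denot_cr procs contr S"
    by (auto simp: denot_cr_def std_denot_def S_def contract_env_def contract_denot_def contr_def relcomp_unfold intro!: exI[of _ "\<lambda>_. 0"])
  then show "\<not> models_cr_par procs contr S (contr ())"
    by (auto simp: models_cr_par_def contract_denot_def contr_def)
qed

end

theory Submission
  imports Defs
begin

text \<open>
  Restricting the contract environment to the procedures that the body calls does not change the
  denotation of the body.  For a non-recursive procedure both sides therefore are the same
  inclusion.  For a recursive one, contract-relative correctness says that the environment mapping
  \<open>p\<close> to its contract is a prefixed point of \<open>xi\<close>, hence an upper bound of the least fixed point.
\<close>

text \<open>Comparing the values of \<open>Call q\<close> rather than the environments lets the two
  sides split the procedures differently into required and provided ones.\<close>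

lemma denot_cong:
  assumes "\<And>q. q \<in> callees S \<Longrightarrow> denot \<rho>m \<rho>p (Call q) = denot \<rho>m' \<rho>p' (Call q)"
  shows "denot \<rho>m \<rho>p S = denot \<rho>m' \<rho>p' S"
  using assms by (induction S) (simp_all del: denot.simps(6))

text \<open>Calls in \<open>P\<close> move from the required to the provided side but keep their
  relation; \<open>\<rho>'\<close> is arbitrary because every callee lies in
  \<open>dom \<rho>\<close>.\<close>

lemma denot_restrict:
  assumes "callees S \<subseteq> dom \<rho>"
  shows "denot (\<rho> |` (callees S - P)) (\<rho> |` P) S = denot \<rho> \<rho>' S"
  by (rule denot_cong) (use assms in \<open>auto simp: rel_at_def restrict_map_def\<close>)

lemma implements_abs_contract_iff:
  fixes contr :: "'p \<Rightarrow> ('v, 'l, 'w) hoare_contract"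
  assumes "procs p = Some S"
  defines "\<rho> \<equiv> contract_env contr |` (callees S - {p})"
  shows "implements (abs_component procs {p}) (abs_contract procs contr p) \<longleftrightarrow>
    std_denot procs {p} \<rho> S \<subseteq> contract_denot (contr p)"
proof -
  have dom: "dom \<rho> = callees S - {p}"
    by (auto simp: \<rho>_def contract_env_def)
  \<comment> \<open>Component and contract require the same procedures, so the top environment is
    empty.\<close>
  have "sup \<rho> (top_env (callees S - {p} - dom \<rho>)) = \<rho>"
    by (simp add: dom top_env_def fun_eq_iff)
  moreover have "abs_contract procs contr p = (\<rho>, contract_env contr |` {p})"
    by (simp add: abs_contract_def \<rho>_def assms(1))
  moreover have "contract_env contr p = Some (contract_denot (contr p))"
    by (simp add: contract_env_def)
  ultimately show ?thesis
    using dom assms(1) by (simp add: implements_def abs_component_def le_fun_def domI)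
qed

text \<open>The equivalence is limited to \<open>p \<notin> callees S\<close> because
  \<open>recursive_counterexample\<close> refutes the converse for recursive procedures.\<close>

theorem theorem5:
  fixes procs :: "('v, 'p::finite) decls"
    and contr :: "'p \<Rightarrow> ('v, 'l, 'w) hoare_contract"
    and p :: 'p and S :: "('v, 'p) stmt"
  assumes "procs p = Some S"
  shows "(p \<notin> callees S \<longrightarrow>
            (models_cr_par procs contr S (contr p) \<longleftrightarrow>
             implements (abs_component procs {p}) (abs_contract procs contr p))) \<and>
         (models_cr_par procs contr S (contr p) \<longrightarrow>
            implements (abs_component procs {p}) (abs_contract procs contr p))"
proof -
  let ?ce = "contract_env contr :: ('v, 'p) env"
  let ?m = "?ce |` (callees S - {p})"
  let ?l = "least_env procs {p} ?m"
  have implements_iff: "implements (abs_component procs {p}) (abs_contract procs contr p) \<longleftrightarrow>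
      denot ?m ?l S \<subseteq> contract_denot (contr p)"
    using implements_abs_contract_iff[of procs p S contr] assms by (simp add: std_denot_def)
  \<comment> \<open>Treating \<open>p\<close> as provided leaves the provided environment as the
    only difference from \<open>implements_iff\<close>.\<close>
  have cr: "denot_cr procs contr S = denot ?m (?ce |` {p}) S"
    unfolding denot_cr_def std_denot_def
    by (rule denot_restrict[symmetric]) (auto simp: contract_env_def)
  have "denot ?m ?l S = denot ?m (?ce |` {p}) S" if "p \<notin> callees S"
    by (rule denot_cong) (use that in \<open>auto simp: contract_env_def\<close>)
  moreover have "denot ?m ?l S \<subseteq> contract_denot (contr p)"
    if *: "denot ?m (?ce |` {p}) S \<subseteq> contract_denot (contr p)"
  proof -
    have "xi procs {p} ?m (?ce |` {p}) \<le> ?ce |` {p}"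
      using * assms by (auto simp: xi_def le_fun_def contract_env_def)
    then have "?l \<le> ?ce |` {p}"
      unfolding least_env_def by (rule lfp_lowerbound)
    then show ?thesis
      using denot_mono * by blast
  qed
  ultimately show ?thesis
    unfolding implements_iff models_cr_par_def cr by auto
qed

end
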